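(* Let $n\ge 1$ and let $\{\ket{e^a_x}\}_{x\in\{0,1\}^n}$, $a\in\mathcal{A}$, be the mutually unbiased bases of $(\mathbb{C}^2)^{\otimes n}$ obtained from a partition of the non-identity $n$-qubit Pauli operators into $2^n+1$ sets of $2^n-1$ pairwise commuting operators. Then two colluding adversaries $\tilde P_0,\tilde P_1$ who pre-share $n$ EPR pairs and use one round of simultaneous classical communication can perfectly break the position-verification protocol based on these bases. That is, there is a strategy in which $\tilde P_0$ is given (only) $a$, $\tilde P_1$ is given (only) the $n$-qubit state $\ket{e^a_x}$, each of them performs local quantum operations, they simultaneously exchange one classical message each, and afterwards both adversaries output $x$ with probability $1$, for all $a$ and all $x\in\{0,1\}^n$.
   Context: Pauli matrices: $\sigma_0=\mathbb{I}$, $\sigma_1=X$, $\sigma_2=Y$, $\sigma_3=Z$. An $n$-qubit Pauli operator is a tensor product of $n$ one-qubit Pauli matrices; there are $4^n$ of them. The $4^n-1$ non-identity Pauli operators can be partitioned into $2^n+1$ disjoint sets, each consisting of $2^n-1$ pairwise commuting operators (known fact). For such a partition, the common eigenvectors of each set form an orthonormal basis of $(\mathbb{C}^2)^{\otimes n}$, and the resulting $2^n+1$ bases are pairwise mutually unbiased, i.e. $|\braket{e^a_x}{e^b_y}|^2=2^{-n}$ for $a\neq b$. The bases are indexed by $a$ in a set $\mathcal{A}$ with $2^n+1$ elements, and $\ket{e^a_x}$ denotes the $x$-th vector of the $a$-th basis. EPR pair: the two-qubit state $\frac1{\sqrt2}(\ket{00}+\ket{11})$, one qubit held by each adversary. The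 protocol: the verifiers $V_0,V_1$ share uniformly random $a,x$ (with $a$ ranging over $2^n$ of the basis labels, identified with $\{0,1\}^n$). $V_0$ sends $a$ and $V_1$ sends $\ket{e^a_x}$ to the prover, arriving simultaneously. The honest prover measures in basis $a$ and sends the outcome $\hat x$ to both verifiers, who accept iff $\hat x$ arrives in time and $\hat x=x$. Adversary $\tilde P_0$ sits between $V_0$ and the claimed position (so receives $a$), $\tilde P_1$ between $V_1$ and the claimed position (so receives the state). Breaking the protocol perfectly means that both adversaries know $x$ with certainty after one round of simultaneous communication. *)

theory Defs
  imports "HOL-Analysis.Analysis"
begin

text \<open>
  The number of qubits is \<open>n = CARD('n)\<close>, so the bound \<open>n \<ge> 1\<close> is automatic. Qubits are labelled
  by \<^typ>\<open>'n\<close>, computational basis states (and bit strings) are functions \<^typ>\<open>'n \<Rightarrow> bool\<close>, and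
  the tensor product of the spaces with basis labels \<open>'i\<close> and \<open>'j\<close> has basis labels \<open>'i \<times> 'j\<close>.
  A matrix of type \<open>complex^'i^'k\<close> maps \<open>complex^'i\<close> to \<open>complex^'k\<close>.
\<close>

type_synonym 'n bits = "'n \<Rightarrow> bool"


section \<open>Linear algebra over the complex numbers\<close>

definition cinner :: "complex^'i \<Rightarrow> complex^'i \<Rightarrow> complex"
  where "cinner u v = (\<Sum>i\<in>UNIV. cnj (u $ i) * v $ i)"

definition adjoint_mat :: "complex^'i^'k \<Rightarrow> complex^'k^'i"
  where "adjoint_mat A = (\<chi> i k. cnj (A $ k $ i))"

definition psd :: "complex^'i^'i \<Rightarrow> bool"
  where "psd A \<longleftrightarrow> adjoint_mat A = A \<and> (\<forall>v. 0 \<le> Re (cinner v (A *v v)))"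

definition tensor_mat :: "complex^'i^'k \<Rightarrow> complex^'j^'l \<Rightarrow> complex^('i \<times> 'j)^('k \<times> 'l)"
  where "tensor_mat A B = (\<chi> p q. A $ fst p $ fst q * B $ snd p $ snd q)"

definition tensor_qubits :: "('n::finite \<Rightarrow> complex^bool^bool) \<Rightarrow> complex^'n bits^'n bits"
  where "tensor_qubits B = (\<chi> u v. \<Prod>i\<in>UNIV. B i $ u i $ v i)"

definition orthonormal_basis :: "('j \<Rightarrow> complex^'i) \<Rightarrow> bool"
  where "orthonormal_basis b \<longleftrightarrow>
    (\<forall>x y. cinner (b x) (b y) = (if x = y then 1 else 0)) \<and> vec.span (range b) = UNIV"


section \<open>Pauli operators and the bases obtained from a partition\<close>

datatype pauli = PI | PX | PY | PZ

text \<open>Here \<^const>\<open>False\<close> is the label of \<open>|0>\<close> and \<^const>\<open>True\<close> the label of \<open>|1>\<close>.\<close>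

fun pauli_matrix :: "pauli \<Rightarrow> complex^bool^bool" where
  "pauli_matrix PI = mat 1"
| "pauli_matrix PX = (\<chi> r c. if r \<noteq> c then 1 else 0)"
| "pauli_matrix PY = (\<chi> r c. if r = c then 0 else if r then \<i> else - \<i>)"
| "pauli_matrix PZ = (\<chi> r c. if r \<noteq> c then 0 else if r then - 1 else 1)"

definition pauli_operators :: "(complex^'n::finite bits^'n bits) set"
  where "pauli_operators = range (\<lambda>p. tensor_qubits (\<lambda>i. pauli_matrix (p i)))"

definition pauli_partition :: "'a set \<Rightarrow> ('a \<Rightarrow> (complex^'n::finite bits^'n bits) set) \<Rightarrow> bool"
  where "pauli_partition A S \<longleftrightarrow>
    card A = 2 ^ CARD('n) + 1 \<and>
    (\<Union>a\<in>A. S a) = pauli_operators - {mat 1} \<and>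
    disjoint_family_on S A \<and>
    (\<forall>a\<in>A. card (S a) = 2 ^ CARD('n) - 1 \<and> (\<forall>P\<in>S a. \<forall>Q\<in>S a. P ** Q = Q ** P))"

text \<open>\<open>e a x\<close> is the vector \<open>|e\<^sup>a\<^sub>x>\<close>. Mutual unbiasedness of the bases is a consequence.\<close>

definition bases_from_partition ::
    "'a set \<Rightarrow> ('a \<Rightarrow> (complex^'n::finite bits^'n bits) set) \<Rightarrow> ('a \<Rightarrow> 'n bits \<Rightarrow> complex^'n bits) \<Rightarrow> bool"
  where "bases_from_partition A S e \<longleftrightarrow>
    (\<forall>a\<in>A. orthonormal_basis (e a) \<and>
      (\<forall>x. \<forall>P\<in>S a. \<exists>c. P *v e a x = c *s e a x))"


section \<open>Attacks with pre-shared EPR pairs\<close>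

definition epr_pair :: "complex^(bool \<times> bool)"
  where "epr_pair = complex_of_real (1 / sqrt 2) *s (axis (False, False) 1 + axis (True, True) 1)"

text \<open>One EPR pair for each \<open>i :: 'n\<close>, the first halves and the second halves being grouped together.\<close>

definition epr_pairs :: "complex^('n::finite bits \<times> 'n bits)"
  where "epr_pairs = (\<chi> r. \<Prod>i\<in>UNIV. epr_pair $ (fst r i, snd r i))"

text \<open>
  The global state before the attack. The first factor is the half of the EPR pairs held by the
  adversary \<open>P0\<close>; the second one belongs to \<open>P1\<close>, who holds the challenge state \<open>v\<close> and the
  other half of the EPR pairs (in this order).
\<close>

definition initial_state :: "complex^'n::finite bits \<Rightarrow> complex^('n bits \<times> ('n bits \<times> 'n bits))"
  where "initial_state v = (\<chi> r. epr_pairs $ (fst r, snd (snd r)) * v $ fst (snd r))"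

text \<open>
  A quantum instrument with classical outcomes in \<open>M\<close>: outcome \<open>m\<close> corresponds to the completely
  positive map with Kraus operators \<open>K m j\<close>, \<open>j < r\<close>.
\<close>

definition instrument :: "bool list set \<Rightarrow> nat \<Rightarrow> (bool list \<Rightarrow> nat \<Rightarrow> complex^'h^'k) \<Rightarrow> bool"
  where "instrument M r K \<longleftrightarrow>
    finite M \<and> (\<Sum>m\<in>M. \<Sum>j<r. adjoint_mat (K m j) ** K m j) = mat 1"

definition povm :: "('n::finite bits \<Rightarrow> complex^'k^'k) \<Rightarrow> bool"
  where "povm E \<longleftrightarrow> (\<forall>x. psd (E x)) \<and> (\<Sum>x\<in>UNIV. E x) = mat 1"

text \<open>
  A strategy with one round of simultaneous classical communication. First, \<open>P0\<close> (who knows \<open>a\<close>)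
  and \<open>P1\<close> apply the instruments \<open>kraus0 a\<close> and \<open>kraus1\<close> to their own registers; the outcomes
  are the messages \<open>m0\<close> and \<open>m1\<close> which are sent to the other adversary. The remaining quantum
  memories have basis labels \<open>'k0\<close> and \<open>'k1\<close>. Finally, the outputs are obtained by measuring the
  memories with \<open>meas0 a m0 m1\<close> and \<open>meas1 m0 m1\<close>.
\<close>

record ('a, 'n::finite, 'k0::finite, 'k1::finite) strategy =
  msgs0 :: "bool list set"
  num0 :: nat
  kraus0 :: "'a \<Rightarrow> bool list \<Rightarrow> nat \<Rightarrow> complex^'n bits^'k0"
  msgs1 :: "bool list set"
  num1 :: nat
  kraus1 :: "bool list \<Rightarrow> nat \<Rightarrow> complex^('n bits \<times> 'n bits)^'k1"
  meas0 :: "'a \<Rightarrow> bool list \<Rightarrow> bool list \<Rightarrow> 'n bits \<Rightarrow> complex^'k0^'k0"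
  meas1 :: "bool list \<Rightarrow> bool list \<Rightarrow> 'n bits \<Rightarrow> complex^'k1^'k1"

definition valid_strategy :: "'a set \<Rightarrow> ('a, 'n::finite, 'k0::finite, 'k1::finite) strategy \<Rightarrow> bool"
  where "valid_strategy A s \<longleftrightarrow>
    (\<forall>a\<in>A. instrument (msgs0 s) (num0 s) (kraus0 s a)) \<and>
    instrument (msgs1 s) (num1 s) (kraus1 s) \<and>
    (\<forall>m0\<in>msgs0 s. \<forall>m1\<in>msgs1 s.
      (\<forall>a\<in>A. povm (meas0 s a m0 m1)) \<and> povm (meas1 s m0 m1))"

text \<open>The probability that both outputs equal \<open>x\<close> for the label \<open>a\<close> and the challenge state \<open>v\<close>.\<close>

definition output_prob ::
    "('a, 'n::finite, 'k0::finite, 'k1::finite) strategy \<Rightarrow> 'a \<Rightarrow> complex^'n bits \<Rightarrow> 'n bits \<Rightarrow> real"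
  where "output_prob s a v x =
    (\<Sum>m0\<in>msgs0 s. \<Sum>m1\<in>msgs1 s. \<Sum>i<num0 s. \<Sum>j<num1 s.
      (let w = tensor_mat (kraus0 s a m0 i) (kraus1 s m1 j) *v initial_state v
       in Re (cinner w (tensor_mat (meas0 s a m0 m1 x) (meas1 s m0 m1 x) *v w))))"

definition perfectly_breaks ::
    "'a set \<Rightarrow> ('a \<Rightarrow> 'n::finite bits \<Rightarrow> complex^'n bits) \<Rightarrow> ('a, 'n, 'k0::finite, 'k1::finite) strategy \<Rightarrow> bool"
  where "perfectly_breaks A e s \<longleftrightarrow>
    valid_strategy A s \<and> (\<forall>a\<in>A. \<forall>x. output_prob s a (e a x) x = 1)"

end

(*
  P1 teleports the challenge state to P0: a Bell measurement of the challenge and of its halves of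
  the EPR pairs has an outcome p, and leaves the state Q_p |e^a_x> with P0, where Q_p is a Pauli
  operator. Each operator P in the set S a commutes with Q_p up to a scalar, hence Q_p |e^a_x> is
  again a common eigenvector of S a. The eigenvalues of S a separate the vectors of the basis: by
  trace orthogonality of the Pauli operators, the 2^n operators in S a together with the identity
  give a square matrix of eigenvalues with orthogonal rows, so its columns are orthogonal too.
  Thus Q_p permutes the basis up to phases. P0 measures in the basis a, getting y, and sends (a, y),
  while P1 sends p; now both know a, y and p, which determine x.
*)

theory Submission
  imports Defs
begin

section \<open>Pauli strings\<close>

lemma UNIV_pauli: "(UNIV :: pauli set) = {PI, PX, PY, PZ}"
  using pauli.exhaust by blast

instance pauli :: finite
  by standard (simp add: UNIV_pauli)

section \<open>From identities on single qubits to identities on tensor products\<close>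

lemma prod_sum_fun:
  fixes f :: "'n::finite \<Rightarrow> 'b::finite \<Rightarrow> 'c::comm_semiring_1"
  shows "(\<Prod>i\<in>UNIV. \<Sum>b\<in>UNIV. f i b) = (\<Sum>g\<in>UNIV. \<Prod>i\<in>UNIV. f i (g i))"
  using prod_sum_PiE[of UNIV "\<lambda>_. UNIV" f] by (simp add: PiE_UNIV_domain)

lemma prod_if_eq:
  fixes c :: "'c::comm_semiring_1" and g h :: "'n::finite \<Rightarrow> 'b"
  shows "(\<Prod>i\<in>UNIV. if g i = h i then c else 0) = (if g = h then c ^ CARD('n) else 0)"
proof (cases "g = h")
  case False
  then obtain i where "g i \<noteq> h i" by blast
  then have "(\<Prod>i\<in>UNIV. if g i = h i then c else 0) = 0"
    by (intro prod_zero) auto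
  with False show ?thesis by simp
qed simp

abbreviation pauli_string :: "('n::finite \<Rightarrow> pauli) \<Rightarrow> complex^'n bits^'n bits"
  where "pauli_string p \<equiv> tensor_qubits (\<lambda>i. pauli_matrix (p i))"

lemma tensor_qubits_mult:
  "tensor_qubits A ** tensor_qubits B = tensor_qubits (\<lambda>i. A i ** B i)"
  by (simp add: tensor_qubits_def matrix_matrix_mult_def vec_eq_iff prod_sum_fun
      flip: prod.distrib)

lemma tensor_qubits_mat_1: "tensor_qubits (\<lambda>_. mat 1) = mat 1"
  by (simp add: tensor_qubits_def mat_def vec_eq_iff prod_if_eq)

lemma trace_tensor_qubits: "trace (tensor_qubits A) = (\<Prod>i\<in>UNIV. trace (A i))"
  by (simp add: trace_def tensor_qubits_def prod_sum_fun)

lemma adjoint_mat_pauli: "adjoint_mat (pauli_matrix p) = pauli_matrix p"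
  by (cases p) (auto simp: adjoint_mat_def vec_eq_iff mat_def)

lemma adjoint_mat_pauli_string: "adjoint_mat (pauli_string p) = pauli_string p"
proof -
  have "cnj (pauli_matrix (p i) $ v i $ u i) = pauli_matrix (p i) $ u i $ v i" for i u v
    using adjoint_mat_pauli[of "p i"] by (simp add: adjoint_mat_def vec_eq_iff)
  then show ?thesis
    by (simp add: adjoint_mat_def tensor_qubits_def vec_eq_iff)
qed

lemma pauli_square: "pauli_matrix p ** pauli_matrix p = mat 1"
  by (cases p) (auto simp: matrix_matrix_mult_def vec_eq_iff mat_def UNIV_bool)

lemma pauli_string_square: "pauli_string p ** pauli_string p = mat 1"
  by (simp add: tensor_qubits_mult pauli_square tensor_qubits_mat_1)

lemma trace_pauli_mult:
  "trace (pauli_matrix p ** pauli_matrix q) = (if p = q then 2 else 0)"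
  by (cases p; cases q)
    (auto simp: trace_def matrix_matrix_mult_def mat_def UNIV_bool)

lemma trace_pauli_string_mult:
  fixes p q :: "'n::finite \<Rightarrow> pauli"
  shows "trace (pauli_string p ** pauli_string q) = (if p = q then 2 ^ CARD('n) else 0)"
  by (simp add: tensor_qubits_mult trace_tensor_qubits trace_pauli_mult prod_if_eq)

text \<open>Two distinct non-identity Pauli matrices anticommute, all other pairs commute. The
  entrywise form lets the signs of the qubits be multiplied in a tensor product.\<close>

lemma pauli_commute_up_to_scalar:
  "\<exists>s. \<forall>u v. (pauli_matrix p ** pauli_matrix q) $ u $ v
    = s * (pauli_matrix q ** pauli_matrix p) $ u $ v"
  by (intro exI[of _ "if p = q \<or> p = PI \<or> q = PI then 1 else - 1"], cases p; cases q)
    (auto simp: matrix_matrix_mult_def mat_def UNIV_bool)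

lemma pauli_string_commute_up_to_scalar:
  "\<exists>s. \<forall>w. pauli_string p *v (pauli_string q *v w) = s *s (pauli_string q *v (pauli_string p *v w))"
proof -
  have "\<exists>s. \<forall>i u v. (pauli_matrix (p i) ** pauli_matrix (q i)) $ u $ v
    = s i * (pauli_matrix (q i) ** pauli_matrix (p i)) $ u $ v"
    using pauli_commute_up_to_scalar by (intro choice allI)
  then obtain s where s: "(pauli_matrix (p i) ** pauli_matrix (q i)) $ u $ v
    = s i * (pauli_matrix (q i) ** pauli_matrix (p i)) $ u $ v" for i u v
    by blast
  have "(pauli_string p ** pauli_string q) $ u $ v
    = prod s UNIV * (pauli_string q ** pauli_string p) $ u $ v" for u v
    unfolding tensor_qubits_mult by (simp add: tensor_qubits_def s prod.distrib)
  then have "pauli_string p *v (pauli_string q *v w)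
    = prod s UNIV *s (pauli_string q *v (pauli_string p *v w))" for w
    unfolding matrix_vector_mul_assoc
    by (simp add: matrix_vector_mult_def vec_eq_iff sum_distrib_left mult.assoc)
  then show ?thesis by blast
qed

text \<open>The Pauli matrices divided by \<open>sqrt 2\<close> are an orthonormal basis of the 2 by
  2 matrices; this is their resolution of the identity.\<close>

lemma pauli_completeness:
  "(\<Sum>p\<in>UNIV. cnj (pauli_matrix p $ u $ t) * pauli_matrix p $ u' $ t')
    = (if (u, t) = (u', t') then 2 else 0)"
  by (auto simp: UNIV_pauli mat_def)

lemma pauli_string_completeness:
  fixes u t u' t' :: "'n::finite bits"
  shows "(\<Sum>p\<in>UNIV. cnj (pauli_string p $ u $ t) * pauli_string p $ u' $ t')
    = (if u = u' \<and> t = t' then 2 ^ CARD('n) else 0)"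
proof -
  have "(\<Sum>p\<in>UNIV. cnj (pauli_string p $ u $ t) * pauli_string p $ u' $ t')
    = (\<Prod>i\<in>UNIV. \<Sum>p\<in>UNIV. cnj (pauli_matrix p $ u i $ t i) * pauli_matrix p $ u' i $ t' i)"
    by (simp add: tensor_qubits_def prod_sum_fun flip: prod.distrib)
  also have "\<dots> = (\<Prod>i\<in>UNIV. if (u i, t i) = (u' i, t' i) then 2 else 0)"
    by (simp only: pauli_completeness)
  also have "\<dots> = (if (\<lambda>i. (u i, t i)) = (\<lambda>i. (u' i, t' i)) then 2 ^ CARD('n) else 0)"
    by (rule prod_if_eq)
  also have "\<dots> = (if u = u' \<and> t = t' then 2 ^ CARD('n) else 0)"
    by (auto simp: fun_eq_iff)
  finally show ?thesis .
qed

section \<open>Orthonormal bases\<close>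

lemma cinner_scale_left: "cinner (c *s u) v = cnj c * cinner u v"
  by (simp add: cinner_def sum_distrib_left mult.assoc)

lemma cinner_scale_right: "cinner u (c *s v) = c * cinner u v"
  by (simp add: cinner_def sum_distrib_left mult_ac)

lemma cinner_adjoint: "cinner (adjoint_mat M *v u) v = cinner u (M *v v)"
  unfolding cinner_def adjoint_mat_def matrix_vector_mult_def
  by (simp add: sum_distrib_left sum_distrib_right mult_ac) (rule sum.swap)

text \<open>There are as many vectors as coordinates, so they are the columns of a square
  \<open>U\<close>, whose left inverse is also a right inverse.\<close>

lemma orthonormal_resolution:
  fixes b :: "'i::finite \<Rightarrow> complex^'i"
  assumes "\<And>x y. cinner (b x) (b y) = (if x = y then 1 else 0)"
  shows "(\<Sum>x\<in>UNIV. b x $ s * cnj (b x $ t)) = (if s = t then 1 else 0)"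
proof -
  define U where "U = (\<chi> s x. b x $ s)"
  have "adjoint_mat U ** U = mat 1"
    using assms by (simp add: U_def adjoint_mat_def matrix_matrix_mult_def mat_def vec_eq_iff cinner_def)
  then have "U ** adjoint_mat U = mat 1"
    by (simp add: matrix_left_right_inverse)
  then show ?thesis
    by (simp add: U_def adjoint_mat_def matrix_matrix_mult_def mat_def vec_eq_iff)
qed

lemma parseval:
  fixes b :: "'i::finite \<Rightarrow> complex^'i"
  assumes "\<And>x y. cinner (b x) (b y) = (if x = y then 1 else 0)"
  shows "(\<Sum>x\<in>UNIV. cnj (cinner (b x) v) * cinner (b x) v) = cinner v v"
proof -
  have "(\<Sum>x\<in>UNIV. cnj (cinner (b x) v) * cinner (b x) v)
    = (\<Sum>x\<in>UNIV. \<Sum>s\<in>UNIV. \<Sum>t\<in>UNIV. cnj (v $ s) * v $ t * (b x $ s * cnj (b x $ t)))"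
    unfolding cinner_def cnj_sum sum_product by (simp add: mult_ac)
  also have "\<dots> = (\<Sum>s\<in>UNIV. \<Sum>x\<in>UNIV. \<Sum>t\<in>UNIV. cnj (v $ s) * v $ t * (b x $ s * cnj (b x $ t)))"
    by (rule sum.swap)
  also have "\<dots> = (\<Sum>s\<in>UNIV. \<Sum>t\<in>UNIV. \<Sum>x\<in>UNIV. cnj (v $ s) * v $ t * (b x $ s * cnj (b x $ t)))"
    by (intro sum.cong refl sum.swap)
  also have "\<dots> = (\<Sum>s\<in>UNIV. \<Sum>t\<in>UNIV. cnj (v $ s) * v $ t * (if s = t then 1 else 0))"
    by (simp add: orthonormal_resolution[OF assms] flip: sum_distrib_left)
  also have "\<dots> = cinner v v"
    by (simp add: cinner_def if_distrib cong: if_cong)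
  finally show ?thesis .
qed

lemma trace_orthonormal_basis:
  fixes b :: "'i::finite \<Rightarrow> complex^'i"
  assumes "\<And>x y. cinner (b x) (b y) = (if x = y then 1 else 0)"
  shows "trace M = (\<Sum>x\<in>UNIV. cinner (b x) (M *v b x))"
proof -
  have "(\<Sum>x\<in>UNIV. cinner (b x) (M *v b x))
    = (\<Sum>x\<in>UNIV. \<Sum>s\<in>UNIV. \<Sum>t\<in>UNIV. M $ s $ t * (b x $ t * cnj (b x $ s)))"
    by (simp add: cinner_def matrix_vector_mult_def sum_distrib_left mult_ac)
  also have "\<dots> = (\<Sum>s\<in>UNIV. \<Sum>x\<in>UNIV. \<Sum>t\<in>UNIV. M $ s $ t * (b x $ t * cnj (b x $ s)))"
    by (rule sum.swap)
  also have "\<dots> = (\<Sum>s\<in>UNIV. \<Sum>t\<in>UNIV. \<Sum>x\<in>UNIV. M $ s $ t * (b x $ t * cnj (b x $ s)))"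
    by (intro sum.cong refl sum.swap)
  also have "\<dots> = (\<Sum>s\<in>UNIV. \<Sum>t\<in>UNIV. M $ s $ t * (if t = s then 1 else 0))"
    by (simp add: orthonormal_resolution[OF assms] flip: sum_distrib_left)
  also have "\<dots> = trace M"
    by (simp add: trace_def if_distrib cong: if_cong)
  finally show ?thesis by simp
qed


section \<open>The action of Pauli operators on the bases\<close>

text \<open>The eigenvalue table \<open>C\<close> is square. The trace of a product of two strings,
  computed in the basis \<open>b\<close>, pairs two rows of \<open>C\<close>; trace orthogonality
  thus makes \<open>D\<close>, the scaled transpose, a right inverse and hence a left
  inverse.\<close>

lemma pauli_eigenvalues_separate:
  fixes q :: "'n::finite bits \<Rightarrow> 'n \<Rightarrow> pauli" and b :: "'n bits \<Rightarrow> complex^'n bits"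
  assumes q: "inj q"
    and b: "\<And>x y. cinner (b x) (b y) = (if x = y then 1 else 0)"
    and c: "\<And>j x. pauli_string (q j) *v b x = c j x *s b x"
    and eq: "\<And>j. c j x = c j y"
  shows "x = y"
proof -
  define C D where "C = (\<chi> j x. c j x)" and "D = (\<chi> x j. c j x / 2 ^ CARD('n))"
  have "(\<Sum>x\<in>UNIV. c j x * c k x) = (if j = k then 2 ^ CARD('n) else 0)" for j k
  proof -
    have "trace (pauli_string (q j) ** pauli_string (q k)) = (\<Sum>x\<in>UNIV. c j x * c k x)"
      by (simp add: trace_orthonormal_basis[OF b] c b cinner_scale_right vector_scalar_commute
          mult.commute flip: matrix_vector_mul_assoc)
    then show ?thesis
      using q by (simp add: trace_pauli_string_mult inj_eq)
  qed
  then have "C ** D = mat 1"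
    by (simp add: C_def D_def matrix_matrix_mult_def mat_def vec_eq_iff flip: sum_divide_distrib)
  then have "D ** C = mat 1"
    by (simp add: matrix_left_right_inverse)
  then have *: "(\<Sum>j\<in>UNIV. c j x / 2 ^ CARD('n) * c j y) = (if x = y then 1 else 0)" for x y
    by (simp add: C_def D_def matrix_matrix_mult_def mat_def vec_eq_iff)
  \<comment> \<open>Under \<open>eq\<close> both instances have the same left-hand side, so the
    delta at \<open>x\<close>, \<open>y\<close> equals the one at \<open>x\<close>,
    \<open>x\<close>, which is 1.\<close>
  show ?thesis
    using *[of x x] *[of x y] by (simp add: eq split: if_splits)
qed

text \<open>Applied first to \<open>b z\<close>, the \<open>j\<close>-th string multiplies a nonzero
  overlap by \<open>c j z\<close>; moved past \<open>pauli_string p\<close> and onto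
  \<open>b y\<close>, it gives a factor independent of \<open>z\<close>. So \<open>x\<close> and
  \<open>x'\<close> have equal eigenvalues.\<close>

lemma pauli_overlap_unique:
  fixes q :: "'n::finite bits \<Rightarrow> 'n \<Rightarrow> pauli" and b :: "'n bits \<Rightarrow> complex^'n bits"
  assumes q: "inj q"
    and b: "\<And>x y. cinner (b x) (b y) = (if x = y then 1 else 0)"
    and c: "\<And>j x. pauli_string (q j) *v b x = c j x *s b x"
    and x: "cinner (b y) (pauli_string p *v b x) \<noteq> 0"
    and x': "cinner (b y) (pauli_string p *v b x') \<noteq> 0"
  shows "x = x'"
proof (rule pauli_eigenvalues_separate[OF q b c])
  fix j
  obtain s where s:
    "\<And>w. pauli_string p *v (pauli_string (q j) *v w) = s *s (pauli_string (q j) *v (pauli_string p *v w))"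
    using pauli_string_commute_up_to_scalar by blast
  have "c j z = s * cnj (c j y)" if "cinner (b y) (pauli_string p *v b z) \<noteq> 0" for z
  proof -
    have "c j z * cinner (b y) (pauli_string p *v b z)
      = cinner (b y) (pauli_string p *v (pauli_string (q j) *v b z))"
      by (simp add: c vector_scalar_commute cinner_scale_right)
    also have "\<dots> = s * cinner (adjoint_mat (pauli_string (q j)) *v b y) (pauli_string p *v b z)"
      by (simp add: s cinner_scale_right cinner_adjoint)
    also have "\<dots> = s * cnj (c j y) * cinner (b y) (pauli_string p *v b z)"
      by (simp add: adjoint_mat_pauli_string c cinner_scale_left)
    finally show ?thesis using that by simp
  qed
  with x x' show "c j x = c j x'" by simp
qed

lemma bases_from_partition_overlap_unique:
  fixes S :: "'a \<Rightarrow> (complex^'n::finite bits^'n bits) set"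
  assumes S: "pauli_partition A S" and e: "bases_from_partition A S e" and a: "a \<in> A"
    and x: "cinner (e a y) (pauli_string p *v e a x) \<noteq> 0"
    and x': "cinner (e a y) (pauli_string p *v e a x') \<noteq> 0"
  shows "x = x'"
proof -
  \<comment> \<open>Adjoining the identity raises \<open>2 ^ n - 1\<close> operators to
    \<open>2 ^ n\<close>, so that they can be indexed by \<open>'n bits\<close>.\<close>
  let ?T = "insert (mat 1) (S a)"
  have sub: "S a \<subseteq> pauli_operators - {mat 1}"
    using S a by (auto simp: pauli_partition_def)
  have "mat 1 \<in> (pauli_operators :: (complex^'n bits^'n bits) set)"
    unfolding pauli_operators_def
    by (rule range_eqI[of _ _ "\<lambda>_. PI"]) (simp add: tensor_qubits_mat_1)
  then have T: "?T \<subseteq> pauli_operators"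
    using sub by auto
  have fin: "finite (S a)"
    using T by (rule finite_subset[OF subset_trans[OF subset_insertI]]) (simp add: pauli_operators_def)
  have "card (S a) = 2 ^ CARD('n) - 1"
    using S a by (auto simp: pauli_partition_def)
  then have "card ?T = CARD('n bits)"
    using sub fin by (simp add: card_fun card_insert_if subset_Diff_insert)
  then obtain g where g: "bij_betw g (UNIV :: 'n bits set) ?T"
    using fin by (metis finite finite_insert finite_same_card_bij)
  have gT: "g j \<in> ?T" for j
    using g by (auto simp: bij_betw_def)
  then have "g j \<in> pauli_operators" for j
    using T by blast
  then have "\<forall>j. \<exists>p. g j = pauli_string p"
    by (auto simp: pauli_operators_def)
  then obtain q where q: "\<And>j. g j = pauli_string (q j)"
    by metis
  have "inj q"
    using g by (metis bij_betw_def inj_def q)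
  moreover have b: "cinner (e a x) (e a y) = (if x = y then 1 else 0)" for x y
    using e a by (simp add: bases_from_partition_def orthonormal_basis_def)
  moreover have "\<forall>j x. \<exists>c. g j *v e a x = c *s e a x"
  proof (intro allI)
    fix j x
    \<comment> \<open>The witness 1 is for the adjoined identity.\<close>
    show "\<exists>c. g j *v e a x = c *s e a x"
      using gT[of j] e a by (auto simp: bases_from_partition_def intro: exI[of _ 1])
  qed
  then obtain c where "\<And>j x. pauli_string (q j) *v e a x = c j x *s e a x"
    unfolding q by metis
  ultimately show ?thesis
    by (rule pauli_overlap_unique[OF _ _ _ x x'])
qed

section \<open>Measurements\<close>

text \<open>The operator \<open>|k><u|\<close>.\<close>

definition collapse :: "'k \<Rightarrow> complex^'i \<Rightarrow> complex^'i^'k"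
  where "collapse k u = (\<chi> r s. if r = k then cnj (u $ s) else 0)"

text \<open>Each Kraus operator contributes the rank-one operator of \<open>f m\<close>. Only a
  resolution of the identity is assumed, so some \<open>f m\<close> may vanish, as happens for
  \<open>P0\<close>.\<close>

lemma instrument_collapse:
  fixes f :: "'m \<Rightarrow> complex^'i::finite" and k :: "'k::finite"
  assumes "finite X" "inj_on enc X"
    and f: "\<And>s t. (\<Sum>m\<in>X. f m $ s * cnj (f m $ t)) = (if s = t then 1 else 0)"
  shows "instrument (enc ` X) 1 (\<lambda>m _. collapse k (f (inv_into X enc m)))"
proof -
  have "adjoint_mat (collapse k u) ** collapse k u = (\<chi> s t. u $ s * cnj (u $ t))" for u :: "complex^'i"
    by (simp add: adjoint_mat_def collapse_def matrix_matrix_mult_def vec_eq_iff if_distrib cong: if_cong)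
  then show ?thesis
    using assms by (simp add: instrument_def sum.reindex vec_eq_iff mat_def)
qed

text \<open>Models a classical output: \<open>y\<close> is announced whatever the memory.\<close>

lemma povm_deterministic:
  "povm (\<lambda>x. if y = x then mat 1 else 0 :: complex^'i::finite^'i)"
proof -
  have "psd (mat 1 :: complex^'i^'i)"
    unfolding psd_def matrix_vector_mul_lid
    by (auto simp: adjoint_mat_def mat_def vec_eq_iff cinner_def intro!: sum_nonneg)
  moreover have "psd (0 :: complex^'i^'i)"
    by (simp add: psd_def adjoint_mat_def vec_eq_iff cinner_def)
  ultimately show ?thesis by (simp add: povm_def)
qed

section \<open>Teleportation through EPR pairs by a Bell measurement\<close>

lemma epr_pairs_nth:
  "epr_pairs $ (s, u) = (if s = u then complex_of_real (1 / sqrt 2) ^ CARD('n) else 0)"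
  for s u :: "'n::finite bits"
proof -
  have "epr_pair $ (s i, u i) = (if s i = u i then complex_of_real (1 / sqrt 2) else 0)" for i
    by (cases "s i"; cases "u i") (simp_all add: epr_pair_def axis_def)
  then show ?thesis
    by (simp add: epr_pairs_def prod_if_eq)
qed

text \<open>
  The conjugate compensates that of \<^const>\<open>collapse\<close>, so that outcome \<open>p\<close> teleports \<open>v\<close> to
  \<open>pauli_string p *v v\<close> without a transpose or conjugate.
\<close>

definition bell :: "('n::finite \<Rightarrow> pauli) \<Rightarrow> complex^('n bits \<times> 'n bits)"
  where "bell p = (\<chi> r. complex_of_real (1 / sqrt 2) ^ CARD('n) * cnj (pauli_string p $ snd r $ fst r))"

lemma sqrt_half_power: "complex_of_real (1 / sqrt 2) ^ n * complex_of_real (1 / sqrt 2) ^ n = 1 / 2 ^ n"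
  by (simp add: power_divide flip: power_mult_distrib of_real_mult)

lemma bell_resolution:
  "(\<Sum>p\<in>UNIV. bell p $ r * cnj (bell p $ r')) = (if r = r' then 1 else 0)"
  for r r' :: "'n::finite bits \<times> 'n bits"
proof -
  let ?c = "complex_of_real (1 / sqrt 2) ^ CARD('n)"
  have "(\<Sum>p\<in>UNIV. bell p $ r * cnj (bell p $ r'))
    = (?c * ?c) * (\<Sum>p\<in>UNIV. cnj (pauli_string p $ snd r $ fst r) * pauli_string p $ snd r' $ fst r')"
    by (simp add: bell_def sum_distrib_left mult_ac)
  then show ?thesis
    unfolding sqrt_half_power by (auto simp: pauli_string_completeness prod_eq_iff)
qed

text \<open>The teleportation identity, with \<open>P0\<close> projecting onto \<open>u\<close>. The
  EPR pairs and the Bell vector each contribute a factor \<open>(1 / sqrt 2) ^ n\<close>.\<close>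

lemma collapse_initial_state:
  fixes u v :: "complex^'n::finite bits"
  shows "tensor_mat (collapse k0 u) (collapse k1 (bell p)) *v initial_state v
    = (cinner u (pauli_string p *v v) / 2 ^ CARD('n)) *s axis (k0, k1) 1"
proof -
  let ?c = "complex_of_real (1 / sqrt 2) ^ CARD('n)"
  have "(\<Sum>r\<in>UNIV. cnj (u $ fst r) * cnj (bell p $ snd r) * initial_state v $ r)
    = (\<Sum>s\<in>UNIV. \<Sum>t\<in>UNIV. \<Sum>w\<in>UNIV. cnj (u $ s) * cnj (bell p $ (t, w)) * initial_state v $ (s, t, w))"
    by (simp add: sum.cartesian_product split_def flip: UNIV_Times_UNIV)
  \<comment> \<open>The EPR pairs force \<open>w = s\<close>, which removes the sum over
    \<open>w\<close>.\<close>
  also have "\<dots> = (\<Sum>s\<in>UNIV. \<Sum>t\<in>UNIV. (?c * ?c) * (cnj (u $ s) * (pauli_string p $ s $ t * v $ t)))"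
    by (intro sum.cong refl) (simp add: bell_def initial_state_def epr_pairs_nth if_distrib if_distribR mult_ac cong: if_cong)
  also have "\<dots> = cinner u (pauli_string p *v v) / 2 ^ CARD('n)"
    unfolding sqrt_half_power
    by (simp add: cinner_def matrix_vector_mult_def sum_distrib_left sum_divide_distrib)
  finally show ?thesis
    by (auto simp: vec_eq_iff tensor_mat_def collapse_def matrix_vector_mult_def axis_def)
qed

lemma cinner_axis_mult:
  "cinner (c *s axis k 1) (M *v (c *s axis k 1)) = cnj c * c * M $ k $ k"
  by (simp add: cinner_def matrix_vector_mult_def axis_def if_distrib if_distribR mult_ac cong: if_cong)

lemma ex_inj_on_bool_list:
  assumes "finite X"
  shows "\<exists>enc :: 'm \<Rightarrow> bool list. inj_on enc X"
proof -
  obtain f :: "'m \<Rightarrow> nat" where "inj_on f X"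
    using finite_imp_inj_to_nat_seg[OF assms] by blast
  \<comment> \<open>A unary code: the length of the list recovers \<open>f x\<close>.\<close>
  then have "inj_on (\<lambda>x. replicate (f x) True) X"
    by (auto simp: inj_on_def)
  then show ?thesis by blast
qed


section \<open>The attack\<close>

text \<open>
  At most one \<open>x\<close> satisfies the condition when the bases come from a partition; the choice is
  arbitrary if there is none, but then the messages have probability zero.
\<close>

definition guess :: "('a \<Rightarrow> 'n::finite bits \<Rightarrow> complex^'n bits) \<Rightarrow> 'a \<times> 'n bits \<Rightarrow> ('n \<Rightarrow> pauli) \<Rightarrow> 'n bits"
  where "guess e m p = (SOME x. cinner (e (fst m) (snd m)) (pauli_string p *v e (fst m) x) \<noteq> 0)"

text \<open>
  The label \<open>a\<close> is part of the message of \<open>P0\<close>. The post-measurement states carry no information: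
  the memories are reset to a fixed basis state, and the final measurements are deterministic.
\<close>

definition teleportation_attack ::
    "'a set \<Rightarrow> ('a \<Rightarrow> 'n::finite bits \<Rightarrow> complex^'n bits) \<Rightarrow> ('a \<times> 'n bits \<Rightarrow> bool list) \<Rightarrow>
      (('n \<Rightarrow> pauli) \<Rightarrow> bool list) \<Rightarrow> ('a, 'n, 'n bits, 'n bits \<times> 'n bits) strategy"
  where "teleportation_attack A e enc0 enc1 =
    (let dec0 = inv_into (A \<times> UNIV) enc0; dec1 = inv_into UNIV enc1 in
     \<lparr>msgs0 = enc0 ` (A \<times> UNIV), num0 = 1,
      kraus0 = (\<lambda>a m _. collapse undefined (if fst (dec0 m) = a then e a (snd (dec0 m)) else 0)),
      msgs1 = range enc1, num1 = 1,
      kraus1 = (\<lambda>m _. collapse undefined (bell (dec1 m))),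
      meas0 = (\<lambda>a m0 m1 x. if guess e (dec0 m0) (dec1 m1) = x then mat 1 else 0),
      meas1 = (\<lambda>m0 m1 x. if guess e (dec0 m0) (dec1 m1) = x then mat 1 else 0)\<rparr>)"

text \<open>The message set of \<open>P0\<close> is the same for all \<open>a\<close>, so it
  contains messages with other labels; their Kraus operators are zero and drop out here.\<close>

lemma sum_label_delta:
  assumes "finite A" "a \<in> A"
  shows "(\<Sum>m\<in>A \<times> UNIV. if fst m = a then f (snd m) else 0) = (\<Sum>y\<in>UNIV. f y)"
proof -
  have "(\<Sum>m\<in>A \<times> UNIV. if fst m = a then f (snd m) else 0)
    = (\<Sum>b\<in>A. \<Sum>y\<in>UNIV. if b = a then f y else 0)"
    by (simp add: sum.cartesian_product split_def)
  also have "\<dots> = (\<Sum>b\<in>A. if b = a then sum f UNIV else 0)"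
    by (intro sum.cong) auto
  finally show ?thesis
    using assms by simp
qed

lemma valid_teleportation_attack:
  assumes A: "finite A"
    and e: "\<And>a x y. a \<in> A \<Longrightarrow> cinner (e a x) (e a y) = (if x = y then 1 else 0)"
    and enc: "inj_on enc0 (A \<times> UNIV)" "inj enc1"
  shows "valid_strategy A (teleportation_attack A e enc0 enc1)"
proof -
  have "(\<Sum>m\<in>A \<times> UNIV. (if fst m = a then e a (snd m) else 0) $ s * cnj ((if fst m = a then e a (snd m) else 0) $ t))
    = (if s = t then 1 else 0)" if a: "a \<in> A" for a s t
  proof -
    have "(\<Sum>m\<in>A \<times> UNIV. (if fst m = a then e a (snd m) else 0) $ s * cnj ((if fst m = a then e a (snd m) else 0) $ t))
      = (\<Sum>m\<in>A \<times> UNIV. if fst m = a then e a (snd m) $ s * cnj (e a (snd m) $ t) else 0)"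
      by (intro sum.cong) auto
    then show ?thesis
      using sum_label_delta[OF A a, of "\<lambda>y. e a y $ s * cnj (e a y $ t)"]
        orthonormal_resolution[OF e[OF a]] by simp
  qed
  then have "\<forall>a\<in>A. instrument (enc0 ` (A \<times> UNIV)) 1 (\<lambda>m _. collapse undefined
      (if fst (inv_into (A \<times> UNIV) enc0 m) = a then e a (snd (inv_into (A \<times> UNIV) enc0 m)) else 0))"
    using A enc
    by (intro ballI instrument_collapse[where f = "\<lambda>m. if fst m = _ then e _ (snd m) else 0"]) auto
  moreover have "instrument (range enc1) 1 (\<lambda>m _. collapse undefined (bell (inv_into UNIV enc1 m)))"
    using enc by (intro instrument_collapse bell_resolution) auto
  ultimately show ?thesis
    by (simp add: valid_strategy_def teleportation_attack_def Let_def povm_deterministic)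
qed

text \<open>The outcomes \<open>y\<close>, \<open>p\<close> have probability
  \<open>?prob y p\<close>, and the guess is right whenever this is nonzero. So the success
  probability is the total probability.\<close>

lemma output_prob_teleportation_attack:
  fixes e :: "'a \<Rightarrow> 'n::finite bits \<Rightarrow> complex^'n bits"
  assumes A: "finite A" and a: "a \<in> A"
    and e: "\<And>x y. cinner (e a x) (e a y) = (if x = y then 1 else 0)"
    and enc: "inj_on enc0 (A \<times> UNIV)" "inj enc1"
    and unique: "\<And>p x x' y. cinner (e a y) (pauli_string p *v e a x) \<noteq> 0 \<Longrightarrow>
      cinner (e a y) (pauli_string p *v e a x') \<noteq> 0 \<Longrightarrow> x = x'"
  shows "output_prob (teleportation_attack A e enc0 enc1) a (e a x) x = 1"
proof -
  let ?amp = "\<lambda>y p. cinner (e a y) (pauli_string p *v e a x)"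
  let ?prob = "\<lambda>y p. cnj (?amp y p / 2 ^ CARD('n)) * (?amp y p / 2 ^ CARD('n))"
  let ?w = "\<lambda>m p. tensor_mat (collapse undefined (if fst m = a then e a (snd m) else 0)) (collapse undefined (bell p))
    *v initial_state (e a x) :: complex^('n bits \<times> 'n bits \<times> 'n bits)"
  let ?E = "\<lambda>m p. tensor_mat (if guess e m p = x then mat 1 else 0) (if guess e m p = x then mat 1 else 0)"
  have guess: "guess e (a, y) p = x" if "?amp y p \<noteq> 0" for y p
    unfolding guess_def fst_conv snd_conv by (rule some_equality, rule that) (rule unique[OF _ that])
  have diag: "?E m p $ (k, l) $ (k, l) = (if guess e m p = x then 1 else 0)" for m p k l
    by (simp add: tensor_mat_def mat_def)
  have summand: "Re (cinner (?w m p) (?E m p *v ?w m p)) = (if fst m = a then Re (?prob (snd m) p) else 0)" for m p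
  proof -
    let ?c = "cinner (if fst m = a then e a (snd m) else 0) (pauli_string p *v e a x) / 2 ^ CARD('n)"
    have "Re (cinner (?w m p) (?E m p *v ?w m p)) = Re (cnj ?c * ?c * (if guess e m p = x then 1 else 0))"
      by (simp only: collapse_initial_state cinner_axis_mult diag)
    also have "\<dots> = (if fst m = a then Re (?prob (snd m) p) else 0)"
    proof (cases "fst m = a")
      case True
      then have "m = (a, snd m)" by (simp add: prod_eq_iff)
      then have "guess e m p = x \<or> ?amp (snd m) p = 0"
        using guess[of "snd m" p] by metis
      with True show ?thesis by (elim disjE) simp_all
    qed (simp add: cinner_def)
    finally show ?thesis .
  qed
  have norm: "(\<Sum>y\<in>UNIV. ?prob y p) = 1 / 4 ^ CARD('n)" for p
  proof -
    \<comment> \<open>A Pauli string is self-adjoint and squares to the identity, so it preserves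
      norms.\<close>
    have "(\<Sum>y\<in>UNIV. cnj (?amp y p) * ?amp y p) = 1"
      unfolding parseval[OF e]
      by (metis adjoint_mat_pauli_string cinner_adjoint e matrix_vector_mul_assoc
          matrix_vector_mul_lid pauli_string_square)
    moreover have "?prob y p = cnj (?amp y p) * ?amp y p / 4 ^ CARD('n)" for y
      by (simp flip: power_mult_distrib)
    ultimately show ?thesis
      by (simp only: flip: sum_divide_distrib)
  qed
  have "output_prob (teleportation_attack A e enc0 enc1) a (e a x) x
    = (\<Sum>m\<in>A \<times> UNIV. \<Sum>p\<in>UNIV. if fst m = a then Re (?prob (snd m) p) else 0)"
    using enc by (simp only: output_prob_def teleportation_attack_def Let_def strategy.simps
        sum.reindex o_def inv_into_f_f UNIV_I summand cong: sum.cong) (simp add: summand)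
  also have "\<dots> = (\<Sum>p\<in>UNIV. \<Sum>m\<in>A \<times> UNIV. if fst m = a then Re (?prob (snd m) p) else 0)"
    by (rule sum.swap)
  also have "\<dots> = (\<Sum>p\<in>UNIV. \<Sum>y\<in>UNIV. Re (?prob y p))"
    by (intro sum.cong refl sum_label_delta[OF A a])
  also have "\<dots> = Re (\<Sum>p\<in>UNIV. \<Sum>y\<in>UNIV. ?prob y p)"
    by (simp only: Re_sum)
  \<comment> \<open>There are \<open>4 ^ n\<close> Pauli strings, each of weight
    \<open>1 / 4 ^ n\<close>.\<close>
  also have "\<dots> = 1"
    unfolding norm by (simp add: card_fun UNIV_pauli)
  finally show ?thesis .
qed

theorem mainTheorem1:
  fixes A :: "'a set"
    and S :: "'a \<Rightarrow> (complex^('n::finite \<Rightarrow> bool)^('n \<Rightarrow> bool)) set"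
    and e :: "'a \<Rightarrow> ('n \<Rightarrow> bool) \<Rightarrow> complex^('n \<Rightarrow> bool)"
  assumes "pauli_partition A S"
    and "bases_from_partition A S e"
  shows "\<exists>s :: ('a, 'n, 'n bits, 'n bits \<times> 'n bits) strategy. perfectly_breaks A e s"
proof -
  \<comment> \<open>Infinite sets have \<open>card\<close> 0, so a nonzero value yields
    finiteness.\<close>
  have "card A \<noteq> 0"
    using assms(1) by (simp add: pauli_partition_def)
  then have A: "finite A"
    by (metis card.infinite)
  have e: "cinner (e a x) (e a y) = (if x = y then 1 else 0)" if "a \<in> A" for a x y
    using assms(2) that by (simp add: bases_from_partition_def orthonormal_basis_def)
  obtain enc0 :: "'a \<times> 'n bits \<Rightarrow> bool list" where enc0: "inj_on enc0 (A \<times> UNIV)"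
    using ex_inj_on_bool_list[of "A \<times> (UNIV :: 'n bits set)"] A by auto
  obtain enc1 :: "('n \<Rightarrow> pauli) \<Rightarrow> bool list" where enc1: "inj enc1"
    using ex_inj_on_bool_list[of "UNIV :: ('n \<Rightarrow> pauli) set"] by auto
  have "output_prob (teleportation_attack A e enc0 enc1) a (e a x) x = 1" if "a \<in> A" for a x
    using bases_from_partition_overlap_unique[OF assms that]
    by (intro output_prob_teleportation_attack A that e enc0 enc1)
  then have "perfectly_breaks A e (teleportation_attack A e enc0 enc1)"
    using valid_teleportation_attack[OF A e enc0 enc1] by (simp add: perfectly_breaks_def)
  then show ?thesis ..
qed

end
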